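(* Let $T\ge 0$ and $x_0=0$. Let $\bar{\mathcal{R}}(T,x_0)$ be the reachable set at time $T$ of the control system $$\dot{x} = a + g(\|x\|)u, \qquad x(0) = x_0,$$ on $\{x\in\mathbb{R}^n \mid \|x\| \leq \|G(0)^\dagger\|^{-1}/(L_f + L_G)\}$, where $a = f(0)$, the inputs take values $u \in \mathbb{B}^n(0;1) \cap \mathrm{Im}(G(0))$, and $g(s) = \|G(0)^\dagger\|^{-1} - (L_f + L_G)s$ for $s \leq \|G(0)^\dagger\|^{-1}/(L_G + L_f)$. Then $\bar{\mathcal{R}}(T,x_0) \subseteq \mathcal{R}^{\mathcal{G}}(T,x_0)$.
   Context: Notation: $\|v\|$ is the Euclidean norm of a vector $v$; $\|M\|=\max_{\|v\|=1}\|Mv\|$ for a matrix $M$; $M^\dagger$ is the Moore-Penrose pseudoinverse; $\mathrm{Im}(M)$ is the range of $M$; $\mathbb{B}^n(a;b)$ is the closed Euclidean ball in $\mathbb{R}^n$ with center $a$ and radius $b\ge 0$. A function $h$ has Lipschitz constant $L$ if $\|h(x)-h(y)\|\le L\|x-y\|$ for all $x,y\in\mathbb{R}^n$. Setting: $L_f>0$ and $L_G>0$ are given; $f:\mathbb{R}^n\to\mathbb{R}^n$ is Lipschitz with constant $L_f$ and $G:\mathbb{R}^n\to\mathbb{R}^{n\times m}$ is Lipschitz with constant $L_G$ (with respect to the matrix norm $\|M\|=\max_{\|v\|=1}\|Mv\|$); $\mathcal{U}=\mathbb{B}^m(0;1)$; the initial state is $x_0=0$. There exist $R\in\mathbb{R}^{n\times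 m}$ and functions $r:\mathbb{R}^n\to\mathbb{R}^m$, $H:\mathbb{R}^n\to\mathbb{R}^{m\times m}$ with $f(x)=Rr(x)$ and $G(x)=RH(x)$ for all $x$, and $H(0)$ invertible (Assumption 1). The values $f(0)$, $G(0)$ and the bounds $L_f,L_G$ are known, and $G(0)\neq 0$ (Assumption 2). Consistent systems: $\mathcal{D}_{con}$ is the set of all pairs $(\hat f,\hat G)$ such that $\hat f:\mathbb{R}^n\to\mathbb{R}^n$ is Lipschitz with constant $L_f$, $\hat G:\mathbb{R}^n\to\mathbb{R}^{n\times m}$ is Lipschitz with constant $L_G$, $\hat f(0)=f(0)$, $\hat G(0)=G(0)$, and there exist $R'\in\mathbb{R}^{n\times m}$, $r':\mathbb{R}^n\to\mathbb{R}^m$, $H':\mathbb{R}^n\to\mathbb{R}^{m\times m}$ with $\hat f=R'r'$, $\hat G=R'H'$ and $H'(0)$ invertible. Reachable sets: $\mathcal{R}^{\hat f,\hat G}(T,x_0)=\{\phi_u^{\hat f,\hat G}(t;x_0)\mid u:[0,T]\to\mathcal{U},\ t\in[0,T]\}$, where $\phi_u^{\hat f,\hat G}(\cdot;x_0)$ is the trajectory of $\dot x=\hat f(x)+\hat G(x)u$, $x(0)=x_0$, with control signal $u$. The guaranteed reachable set is $\mathcal{R}^{\mathcal{G}}(T,x_0)=\bigcap_{(\hat f,\hat G)\in\mathcal{D}_{con}}\mathcal{R}^{\hat f,\hat G}(T,x_0)$. The reachable set at time $T$ of a control system given on a domain is, analogously, the set of points $\phi(t)$, $t\in[0,T]$,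 where $\phi$ is a trajectory from $x_0$ that stays in the domain on $[0,t]$. Control signals are measurable and trajectories are absolutely continuous, satisfying the dynamics almost everywhere. *)

theory Defs
  imports "HOL-Analysis.Analysis"
begin

text \<open>
  The spectral norm. The norm of the type \<^typ>\<open>real^'m^'n\<close> is the Frobenius norm, which is not
  the one used here.
\<close>
definition mat_norm :: "real^'m^'n \<Rightarrow> real" where
  "mat_norm M = onorm ((*v) M)"

text \<open>
  The Moore-Penrose pseudoinverse, as the unique solution of the four Penrose equations.
\<close>
definition is_pinv :: "real^'m^'n \<Rightarrow> real^'n^'m \<Rightarrow> bool" where
  "is_pinv M P \<longleftrightarrow>
     M ** P ** M = M \<and> P ** M ** P = P \<and>
     transpose (M ** P) = M ** P \<and> transpose (P ** M) = P ** M"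

definition pinv :: "real^'m^'n \<Rightarrow> real^'n^'m" where
  "pinv M = (THE P. is_pinv M P)"

definition mat_lipschitz :: "real \<Rightarrow> (real^'n \<Rightarrow> real^'m^'n) \<Rightarrow> bool" where
  "mat_lipschitz L G \<longleftrightarrow> (\<forall>x y. mat_norm (G x - G y) \<le> L * norm (x - y))"

definition factorizable :: "(real^'n \<Rightarrow> real^'n) \<Rightarrow> (real^'n \<Rightarrow> real^'m^'n) \<Rightarrow> bool" where
  "factorizable f G \<longleftrightarrow>
     (\<exists>(R :: real^'m^'n) (r :: real^'n \<Rightarrow> real^'m) (H :: real^'n \<Rightarrow> real^'m^'m).
        (\<forall>x. f x = R *v r x) \<and> (\<forall>x. G x = R ** H x) \<and> invertible (H 0))"

definition consistent_systems ::
  "real \<Rightarrow> real \<Rightarrow> (real^'n \<Rightarrow> real^'n) \<Rightarrow> (real^'n \<Rightarrow> real^'m^'n) \<Rightarrow>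
   ((real^'n \<Rightarrow> real^'n) \<times> (real^'n \<Rightarrow> real^'m^'n)) set" where
  "consistent_systems Lf LG f G =
     {(f', G'). Lf-lipschitz_on UNIV f' \<and> mat_lipschitz LG G' \<and>
                f' 0 = f 0 \<and> G' 0 = G 0 \<and> factorizable f' G'}"

definition abs_continuous_on :: "real \<Rightarrow> real \<Rightarrow> (real \<Rightarrow> 'a::real_normed_vector) \<Rightarrow> bool" where
  "abs_continuous_on a b \<phi> \<longleftrightarrow>
     (\<forall>\<epsilon>>0. \<exists>\<delta>>0. \<forall>(k::nat) l r.
        (\<forall>i<k. a \<le> l i \<and> l i \<le> r i \<and> r i \<le> b) \<and>
        disjoint_family_on (\<lambda>i. {l i<..<r i}) {..<k} \<and>
        (\<Sum>i<k. r i - l i) < \<delta> \<longrightarrow>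
        (\<Sum>i<k. norm (\<phi> (r i) - \<phi> (l i))) < \<epsilon>)"

text \<open>
  Signals and trajectories are total functions on \<^typ>\<open>real\<close> of which only the values on the
  interval \<open>[0, T]\<close> matter. A controlled vector field \<open>F\<close> takes the state and the input.
\<close>
definition control_signal :: "'u::euclidean_space set \<Rightarrow> real \<Rightarrow> (real \<Rightarrow> 'u) \<Rightarrow> bool" where
  "control_signal U T u \<longleftrightarrow>
     u \<in> borel_measurable (lebesgue_on {0..T}) \<and> (\<forall>t\<in>{0..T}. u t \<in> U)"

definition trajectory ::
  "('x::euclidean_space \<Rightarrow> 'u \<Rightarrow> 'x) \<Rightarrow> 'x \<Rightarrow> real \<Rightarrow> (real \<Rightarrow> 'u) \<Rightarrow> (real \<Rightarrow> 'x) \<Rightarrow> bool" where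
  "trajectory F x0 T u \<phi> \<longleftrightarrow>
     abs_continuous_on 0 T \<phi> \<and> \<phi> 0 = x0 \<and>
     (AE t in lebesgue_on {0..T}.
        (\<phi> has_vector_derivative F (\<phi> t) (u t)) (at t within {0..T}))"

definition reachable_set ::
  "('x::euclidean_space \<Rightarrow> 'u::euclidean_space \<Rightarrow> 'x) \<Rightarrow> 'u set \<Rightarrow> real \<Rightarrow> 'x \<Rightarrow> 'x set" where
  "reachable_set F U T x0 =
     {\<phi> t | u \<phi> t. t \<in> {0..T} \<and> control_signal U T u \<and> trajectory F x0 T u \<phi>}"

text \<open>
  For a system on a domain \<open>D\<close>, the trajectory need only exist, and remain in \<open>D\<close>, up to the
  time at which the point is reached.
\<close>
definition reachable_set_in ::
  "'x set \<Rightarrow> ('x::euclidean_space \<Rightarrow> 'u::euclidean_space \<Rightarrow> 'x) \<Rightarrow> 'u set \<Rightarrow> real \<Rightarrow> 'x \<Rightarrow> 'x set"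
  where
  "reachable_set_in D F U T x0 =
     {\<phi> t | u \<phi> t. t \<in> {0..T} \<and> control_signal U t u \<and> trajectory F x0 t u \<phi> \<and>
                  (\<forall>s\<in>{0..t}. \<phi> s \<in> D)}"

definition guaranteed_reachable_set ::
  "real \<Rightarrow> real \<Rightarrow> (real^'n \<Rightarrow> real^'n) \<Rightarrow> (real^'n \<Rightarrow> real^'m^'n) \<Rightarrow> real \<Rightarrow> real^'n \<Rightarrow> (real^'n) set"
  where
  "guaranteed_reachable_set Lf LG f G T x0 =
     (\<Inter>(f', G') \<in> consistent_systems Lf LG f G.
        reachable_set (\<lambda>x u. f' x + G' x *v u) (cball 0 1) T x0)"

end

theory Submission
  imports Defs
begin

text \<open>
  Write \<open>p = \<parallel>P\<parallel>\<close> for the norm of the pseudoinverse \<open>P\<close> of \<open>G 0\<close>. The proof follows one trajectory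
  \<open>\<phi>\<close> of the comparison system, with input \<open>u\<close>, and shows that every consistent system
  \<open>(f', G')\<close> can follow it as well, with an input of its own.

  To have velocity \<open>f 0 + g \<parallel>\<phi>\<parallel> u\<close>, the consistent system must solve \<open>G' \<phi> v = w\<close> for
  \<open>w = g \<parallel>\<phi>\<parallel> u - (f' \<phi> - f' 0)\<close>. Two losses have to be paid for at distance \<open>s = \<parallel>\<phi>\<parallel>\<close> from the origin.
  The drift moves by at most \<open>Lf s\<close>, so that \<open>\<parallel>w\<parallel> \<le> 1/p - (Lf + LG) s + Lf s = 1/p - LG s\<close>. The input
  matrix moves by at most \<open>LG s\<close>, so that it still produces every vector in the range of \<open>G 0\<close> of norm at
  most \<open>1/p - LG s\<close> from an input in the unit ball. The two bounds are equal: the slope \<open>Lf + LG\<close> of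
  \<open>g\<close> is the sum of the two losses.

  The common factor \<open>R\<close> enters through the range (\<open>factorizable_range\<close>): all values of \<open>f'\<close> and
  \<open>G'\<close> lie in the range of \<open>G 0\<close>, hence so does \<open>w\<close>, and on that range \<open>P\<close> is a right inverse of
  \<open>G 0\<close>. There the equation can be solved by inverting the square matrix \<open>1 + (G' \<phi> - G 0) P\<close>, a
  perturbation of the identity of size at most \<open>LG s p < 1\<close> (\<open>perturbed_right_inverse\<close>). Cramer's rule shows
  that the resulting input depends measurably on time (\<open>control_signal_realizing_velocity\<close>).

  The comparison trajectory need exist only until it reaches the point in question, whereas a
  reachable point of \<open>(f', G')\<close> must lie on a trajectory over all of \<open>[0, T]\<close>. Since \<open>f'\<close> is
  Lipschitz on the whole space, the motion can be prolonged with zero input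
  (\<open>lipschitz_ode_solution_exists\<close>, \<open>trajectory_endpoint_reachable\<close>).
\<close>

section \<open>Spectral norm and pseudoinverse\<close>

lemma norm_mult_le_mat_norm:
  fixes M :: "real^'m^'n"
  shows "norm (M *v x) \<le> mat_norm M * norm x"
  unfolding mat_norm_def by (rule onorm) (simp add: matrix_vector_mul_bounded_linear)

lemma mat_norm_pos:
  fixes M :: "real^'m^'n"
  assumes "M \<noteq> 0"
  shows "0 < mat_norm M"
proof -
  have "\<not> (\<forall>x. M *v x = 0)"
    using assms by (metis matrix_eq matrix_vector_mult_0)
  then show ?thesis
    unfolding mat_norm_def
    by (subst onorm_pos_lt) (simp_all add: matrix_vector_mul_bounded_linear)
qed

lemma mat_norm_nonneg:
  fixes M :: "real^'m^'n"
  shows "0 \<le> mat_norm M"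
  unfolding mat_norm_def by (rule onorm_pos_le) (simp add: matrix_vector_mul_bounded_linear)

lemma abs_entry_le_mat_norm:
  fixes M :: "real^'m^'n"
  shows "\<bar>M $ i $ j\<bar> \<le> mat_norm M"
proof -
  have "\<bar>M $ i $ j\<bar> = \<bar>(M *v axis j 1) $ i\<bar>"
    by (simp add: matrix_vector_mult_basis column_def)
  also have "\<dots> \<le> norm (M *v axis j 1)"
    by (rule component_le_norm_cart)
  also have "\<dots> \<le> mat_norm M * norm (axis j (1::real))"
    by (rule norm_mult_le_mat_norm)
  finally show ?thesis by simp
qed

lemma mat_lipschitz_imp_continuous:
  fixes G :: "real^'n \<Rightarrow> real^'m^'n"
  assumes "mat_lipschitz L G"
  shows "continuous_on UNIV G"
proof -
  have "continuous_on UNIV (\<lambda>x. G x $ i $ j)" for i j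
  proof (rule lipschitz_on_continuous_on)
    show "\<bar>L\<bar>-lipschitz_on UNIV (\<lambda>x. G x $ i $ j)"
    proof (rule lipschitz_onI)
      fix x y
      have "\<bar>(G x - G y) $ i $ j\<bar> \<le> mat_norm (G x - G y)"
        by (rule abs_entry_le_mat_norm)
      also have "\<dots> \<le> L * norm (x - y)"
        using assms by (simp add: mat_lipschitz_def)
      also have "\<dots> \<le> \<bar>L\<bar> * norm (x - y)"
        by (intro mult_right_mono) auto
      finally show "dist (G x $ i $ j) (G y $ i $ j) \<le> \<bar>L\<bar> * dist x y"
        by (simp add: dist_norm)
    qed simp
  qed
  then have "continuous_on UNIV (\<lambda>x. \<chi> i j. G x $ i $ j)"
    by (intro continuous_on_vec_lambda)
  then show ?thesis by simp
qed

text \<open>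
  The chain \<open>M P = M Q M P = (M P M Q)\<^sup>T = M Q\<close>, its mirror image \<open>P M = Q M\<close>, and
  \<open>P = P M P = P M Q = Q M Q = Q\<close>.
\<close>
lemma is_pinv_unique:
  fixes M :: "real^'m^'n"
  assumes P: "is_pinv M P" and Q: "is_pinv M Q"
  shows "P = Q"
proof -
  have P1: "M ** P ** M = M" and P2: "P ** M ** P = P"
    and P3: "transpose (M ** P) = M ** P" and P4: "transpose (P ** M) = P ** M"
    using P by (auto simp: is_pinv_def)
  have Q1: "M ** Q ** M = M" and Q2: "Q ** M ** Q = Q"
    and Q3: "transpose (M ** Q) = M ** Q" and Q4: "transpose (Q ** M) = Q ** M"
    using Q by (auto simp: is_pinv_def)
  have "M ** P = transpose ((M ** Q ** M) ** P)" by (simp only: Q1 P3)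
  also have "\<dots> = transpose ((M ** Q) ** (M ** P))" by (simp only: matrix_mul_assoc)
  also have "\<dots> = (M ** P) ** (M ** Q)" by (simp only: matrix_transpose_mul[of "M ** Q"] P3 Q3)
  also have "\<dots> = (M ** P ** M) ** Q" by (simp only: matrix_mul_assoc)
  finally have MP: "M ** P = M ** Q" by (simp only: P1)
  have "P ** M = transpose (P ** (M ** Q ** M))" by (simp only: Q1 P4)
  also have "\<dots> = transpose ((P ** M) ** (Q ** M))" by (simp only: matrix_mul_assoc)
  also have "\<dots> = (Q ** M) ** (P ** M)" by (simp only: matrix_transpose_mul[of "P ** M"] P4 Q4)
  also have "\<dots> = Q ** (M ** P ** M)" by (simp only: matrix_mul_assoc)
  finally have PM: "P ** M = Q ** M" by (simp only: P1)
  have "P = (P ** M) ** P" by (simp only: P2)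
  also have "\<dots> = (Q ** M) ** P" by (simp only: PM)
  also have "\<dots> = Q ** (M ** P)" by (simp only: matrix_mul_assoc)
  also have "\<dots> = Q ** (M ** Q)" by (simp only: MP)
  also have "\<dots> = (Q ** M) ** Q" by (simp only: matrix_mul_assoc)
  also have "\<dots> = Q" by (rule Q2)
  finally show ?thesis .
qed

text \<open>
  The witness sends \<open>y\<close> to the least-squares solution of \<open>M x = y\<close> of minimal norm: the only \<open>v\<close>
  orthogonal to the kernel of \<open>M\<close> whose residual \<open>y - M v\<close> is orthogonal to the range of \<open>M\<close>.
  Uniqueness of \<open>v\<close> makes the assignment linear and gives the two absorption equations; the
  orthogonality of the two errors makes \<open>M P\<close> and \<open>P M\<close> self-adjoint.
\<close>
lemma is_pinv_exists:
  fixes M :: "real^'m^'n"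
  shows "\<exists>P. is_pinv M P"
proof -
  define V where "V = {v. \<forall>k. M *v k = 0 \<longrightarrow> v \<bullet> k = 0}"
  define W where "W = {w. \<forall>x. w \<bullet> (M *v x) = 0}"
  have V_add: "v + w \<in> V" and V_diff: "v - w \<in> V" and V_scale: "c *\<^sub>R v \<in> V"
    if "v \<in> V" "w \<in> V" for v w c
    using that by (auto simp: V_def inner_add_left inner_diff_left)
  have W_add: "v + w \<in> W" and W_diff: "v - w \<in> W" and W_scale: "c *\<^sub>R v \<in> W"
    if "v \<in> W" "w \<in> W" for v w c
    using that by (auto simp: W_def inner_add_left inner_diff_left)
  have decomp: "\<exists>v\<in>V. M *v x = M *v v" for x
  proof -
    have sub: "subspace {k. M *v k = 0}"
      by (rule linear_subspace_kernel) simp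
    obtain k v where kv: "k \<in> span {k. M *v k = 0}"
        "\<And>w. w \<in> span {k. M *v k = 0} \<Longrightarrow> orthogonal v w" "x = k + v"
      using orthogonal_subspace_decomp_exists[of "{k. M *v k = 0}" x] by metis
    have "M *v k = 0" using kv(1) sub by (simp add: span_eq_iff[THEN iffD2])
    moreover have "v \<in> V"
      using kv(2) by (auto simp: V_def orthogonal_def intro: span_base)
    ultimately show ?thesis
      using kv(3) by (auto simp: matrix_vector_right_distrib)
  qed
  have ex: "\<exists>v\<in>V. y - M *v v \<in> W" for y
  proof -
    have sub: "subspace (range ((*v) M))"
      by (rule linear_subspace_image) auto
    obtain p q where pq: "p \<in> span (range ((*v) M))"
        "\<And>w. w \<in> span (range ((*v) M)) \<Longrightarrow> orthogonal q w" "y = p + q"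
      using orthogonal_subspace_decomp_exists[of "range ((*v) M)" y] by metis
    then obtain x where "p = M *v x"
      using sub by (auto simp: span_eq_iff[THEN iffD2])
    moreover obtain v where "v \<in> V" "M *v x = M *v v" using decomp by blast
    moreover have "q \<in> W" using pq(2) by (auto simp: W_def orthogonal_def intro: span_base)
    ultimately show ?thesis using pq(3) by (intro bexI[of _ v]) auto
  qed
  have uniq: "v = w" if "v \<in> V" "w \<in> V" "y - M *v v \<in> W" "y - M *v w \<in> W" for y v w
  proof -
    have "M *v (v - w) = (y - M *v w) - (y - M *v v)"
      by (simp add: matrix_vector_mult_diff_distrib)
    then have "M *v (v - w) \<in> W"
      using W_diff[OF that(4,3)] by simp
    then have "M *v (v - w) = 0"
      by (auto simp: W_def dest!: spec[of _ "v - w"])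
    then have "(v - w) \<bullet> (v - w) = 0"
      using V_diff[OF that(1,2)] by (simp add: V_def)
    then show ?thesis by simp
  qed
  define h where "h y = (SOME v. v \<in> V \<and> y - M *v v \<in> W)" for y
  have h: "h y \<in> V" "y - M *v h y \<in> W" for y
    using someI_ex[of "\<lambda>v. v \<in> V \<and> y - M *v v \<in> W"] ex[of y] unfolding h_def by auto
  have "linear h"
  proof (rule linearI)
    fix y z c
    show "h (y + z) = h y + h z"
    proof (rule uniq[of _ _ "y + z"])
      show "y + z - M *v (h y + h z) \<in> W"
        using W_add[OF h(2)[of y] h(2)[of z]]
        by (simp add: matrix_vector_right_distrib algebra_simps)
    qed (auto intro: V_add h)
    show "h (c *\<^sub>R y) = c *\<^sub>R h y"
    proof (rule uniq[of _ _ "c *\<^sub>R y"])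
      show "c *\<^sub>R y - M *v (c *\<^sub>R h y) \<in> W"
        using W_scale[OF h(2)[of y] h(2)[of y], of c]
        by (simp add: scaleR_right_diff_distrib matrix_vector_mult_scaleR)
    qed (auto intro: V_scale h)
  qed
  then have P: "matrix h *v y = h y" for y by (simp add: matrix_works)
  have "0 \<in> W" by (simp add: W_def)
  have MhM: "M *v h (M *v x) = M *v x" for x
  proof -
    obtain v where v: "v \<in> V" "M *v x = M *v v" using decomp by blast
    have "h (M *v x) = v"
      using h(1) v(1) h(2) by (rule uniq) (use v(2) \<open>0 \<in> W\<close> in simp)
    then show ?thesis using v by simp
  qed
  have hMh: "h (M *v h y) = h y" for y
    by (rule uniq[of _ _ "M *v h y"]) (use h \<open>0 \<in> W\<close> in auto)
  have symI: "transpose N = N" if "\<And>x y. (N *v x) \<bullet> y = x \<bullet> (N *v y)" for N :: "real^'k^'k"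
  proof -
    have "x v* N = N *v x" for x
    proof -
      have "(x v* N) \<bullet> y = (N *v x) \<bullet> y" for y
        by (simp add: that dot_lmul_matrix)
      then show ?thesis by (metis vector_eq_rdot)
    qed
    then show ?thesis by (simp add: matrix_eq)
  qed
  have res: "(M *v h z) \<bullet> (z - M *v h z) = 0" "(M *v h y) \<bullet> (z - M *v h z) = 0" for y z
    using h(2)[of z] by (auto simp: W_def inner_commute)
  have "(M *v h y) \<bullet> z = y \<bullet> (M *v h z)" for y z
    using res(2)[of y z] res(2)[of z y] by (simp add: inner_diff_right inner_commute)
  moreover have res': "h (M *v y) \<bullet> (z - h (M *v z)) = 0" for y z
  proof -
    have "M *v (z - h (M *v z)) = 0" by (simp add: matrix_vector_mult_diff_distrib MhM)
    then show ?thesis using h(1)[of "M *v y"] by (simp add: V_def)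
  qed
  have "h (M *v y) \<bullet> z = y \<bullet> h (M *v z)" for y z
    using res'[of y z] res'[of z y] by (simp add: inner_diff_right inner_commute)
  ultimately have "transpose (M ** matrix h) = M ** matrix h"
      "transpose (matrix h ** M) = matrix h ** M"
    by (auto simp: matrix_vector_mul_assoc[symmetric] P intro!: symI)
  then have "is_pinv M (matrix h)"
    by (simp add: is_pinv_def matrix_eq matrix_vector_mul_assoc[symmetric] P MhM hMh)
  then show ?thesis ..
qed

lemma is_pinv_pinv: "is_pinv M (pinv M)"
proof -
  obtain P where P: "is_pinv M P" using is_pinv_exists by blast
  show ?thesis
    unfolding pinv_def using P is_pinv_unique[OF _ P] by (rule theI[of "is_pinv M" P])
qed

section \<open>Measurable solutions of linear systems\<close>

lemma borel_measurable_vecI: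
  fixes z :: "'a \<Rightarrow> real^'n"
  assumes "\<And>i. (\<lambda>s. z s $ i) \<in> borel_measurable M"
  shows "z \<in> borel_measurable M"
proof (subst borel_measurable_euclidean_space, rule ballI)
  fix b :: "real^'n" assume "b \<in> Basis"
  then obtain i where b: "b = axis i 1" by (auto simp: Basis_vec_def)
  show "(\<lambda>s. z s \<bullet> b) \<in> borel_measurable M"
    unfolding b inner_axis using assms[of i] by simp
qed

text \<open>Cramer's rule writes the solution as a rational function of the data.\<close>
lemma borel_measurable_linear_system:
  fixes A :: "'a \<Rightarrow> real^'n^'n" and b z :: "'a \<Rightarrow> real^'n"
  assumes A: "A \<in> borel_measurable M" and b: "b \<in> borel_measurable M"
    and det: "\<And>s. s \<in> space M \<Longrightarrow> det (A s) \<noteq> 0"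
    and z: "\<And>s. s \<in> space M \<Longrightarrow> A s *v z s = b s"
  shows "z \<in> borel_measurable M"
proof (rule borel_measurable_vecI)
  fix k
  have entry: "(\<lambda>s. A s $ i $ j) \<in> borel_measurable M" for i j
  proof -
    have "(\<lambda>s. A s \<bullet> axis i (axis j 1)) \<in> borel_measurable M"
      using A by simp
    then show ?thesis by (simp add: inner_axis)
  qed
  have comp: "(\<lambda>s. b s $ i) \<in> borel_measurable M" for i
  proof -
    have "(\<lambda>s. b s \<bullet> axis i 1) \<in> borel_measurable M"
      using b by simp
    then show ?thesis by (simp add: inner_axis)
  qed
  have "(\<lambda>s. if c then b s $ i else A s $ i $ j) \<in> borel_measurable M" for c i j
    by (cases c) (simp_all add: entry comp)
  then have "(\<lambda>s. det (\<chi> i j. if j = k then b s $ i else A s $ i $ j) / det (A s)) \<in> borel_measurable M"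
    unfolding det_def
    by (intro borel_measurable_divide borel_measurable_sum borel_measurable_times
        borel_measurable_prod borel_measurable_const)
      (simp_all add: entry)
  moreover have "z s $ k = det (\<chi> i j. if j = k then b s $ i else A s $ i $ j) / det (A s)"
    if "s \<in> space M" for s
    using z[OF that] unfolding cramer[OF det[OF that]] by simp
  ultimately show "(\<lambda>s. z s $ k) \<in> borel_measurable M"
    by (simp cong: measurable_cong)
qed

section \<open>Absolute continuity\<close>

lemma abs_continuous_on_imp_continuous_on:
  assumes "abs_continuous_on a b \<phi>"
  shows "continuous_on {a..b} \<phi>"
proof (unfold continuous_on_iff, intro ballI allI impI)
  fix s \<epsilon> :: real
  assume s: "s \<in> {a..b}" and "\<epsilon> > 0"
  obtain \<delta> where "\<delta> > 0" and \<delta>: "\<forall>(k::nat) l r.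
        (\<forall>i<k. a \<le> l i \<and> l i \<le> r i \<and> r i \<le> b) \<and>
        disjoint_family_on (\<lambda>i. {l i<..<r i}) {..<k} \<and> (\<Sum>i<k. r i - l i) < \<delta> \<longrightarrow>
        (\<Sum>i<k. norm (\<phi> (r i) - \<phi> (l i))) < \<epsilon>"
    using mp[OF spec[OF assms[unfolded abs_continuous_on_def]] \<open>\<epsilon> > 0\<close>] by (elim exE conjE)
  have "dist (\<phi> s') (\<phi> s) < \<epsilon>" if "s' \<in> {a..b}" "dist s' s < \<delta>" for s'
  proof -
    have "norm (\<phi> (max s s') - \<phi> (min s s')) < \<epsilon>"
      using \<delta>[rule_format, of 1 "\<lambda>_. min s s'" "\<lambda>_. max s s'"] s that
      by (auto simp: disjoint_family_on_def dist_real_def min_def max_def abs_if split: if_splits)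
    then show ?thesis
      by (auto simp: dist_norm max_def min_def norm_minus_commute split: if_splits)
  qed
  then show "\<exists>d>0. \<forall>x'\<in>{a..b}. dist x' s < d \<longrightarrow> dist (\<phi> x') (\<phi> s) < \<epsilon>"
    using \<open>\<delta> > 0\<close> by blast
qed

lemma lipschitz_on_imp_abs_continuous_on:
  assumes "C-lipschitz_on {a..b} \<phi>"
  shows "abs_continuous_on a b \<phi>"
  unfolding abs_continuous_on_def
proof (intro allI impI)
  fix \<epsilon> :: real assume "\<epsilon> > 0"
  have "C \<ge> 0" using assms by (rule lipschitz_on_nonneg)
  show "\<exists>\<delta>>0. \<forall>(k::nat) l r. (\<forall>i<k. a \<le> l i \<and> l i \<le> r i \<and> r i \<le> b) \<and>
      disjoint_family_on (\<lambda>i. {l i<..<r i}) {..<k} \<and> (\<Sum>i<k. r i - l i) < \<delta> \<longrightarrow>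
      (\<Sum>i<k. norm (\<phi> (r i) - \<phi> (l i))) < \<epsilon>"
  proof (intro exI[of _ "\<epsilon> / (C + 1)"] conjI allI impI)
    fix k :: nat and l r :: "nat \<Rightarrow> real"
    assume *: "(\<forall>i<k. a \<le> l i \<and> l i \<le> r i \<and> r i \<le> b) \<and>
      disjoint_family_on (\<lambda>i. {l i<..<r i}) {..<k} \<and> (\<Sum>i<k. r i - l i) < \<epsilon> / (C + 1)"
    have "(\<Sum>i<k. norm (\<phi> (r i) - \<phi> (l i))) \<le> (\<Sum>i<k. (C + 1) * (r i - l i))"
    proof (rule sum_mono)
      fix i assume "i \<in> {..<k}"
      then have i: "a \<le> l i" "l i \<le> r i" "r i \<le> b" using * by auto
      then have "norm (\<phi> (r i) - \<phi> (l i)) \<le> C * (r i - l i)"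
        using lipschitz_onD[OF assms, of "r i" "l i"] by (simp add: dist_norm)
      also have "\<dots> \<le> (C + 1) * (r i - l i)" using i by (intro mult_right_mono) auto
      finally show "norm (\<phi> (r i) - \<phi> (l i)) \<le> (C + 1) * (r i - l i)" .
    qed
    also have "\<dots> = (C + 1) * (\<Sum>i<k. r i - l i)" by (simp add: sum_distrib_left)
    also have "\<dots> < \<epsilon>" using * \<open>C \<ge> 0\<close> by (simp add: field_simps)
    finally show "(\<Sum>i<k. norm (\<phi> (r i) - \<phi> (l i))) < \<epsilon>" .
  qed (use \<open>\<epsilon> > 0\<close> \<open>C \<ge> 0\<close> in auto)
qed

text \<open>
  Every interval is cut at the junction \<open>b\<close>; both families of pieces are again disjoint and no
  longer in total than the original one.
\<close>
lemma abs_continuous_on_join: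
  assumes \<phi>: "abs_continuous_on a b \<phi>" and \<xi>: "abs_continuous_on b c \<xi>"
    and eq: "\<phi> b = \<xi> b" and ab: "a \<le> b" and bc: "b \<le> c"
  shows "abs_continuous_on a c (\<lambda>s. if s \<le> b then \<phi> s else \<xi> s)"
  unfolding abs_continuous_on_def
proof (intro allI impI)
  fix \<epsilon> :: real assume "\<epsilon> > 0"
  then have "\<epsilon> / 2 > 0" by simp
  obtain \<delta>1 where "\<delta>1 > 0" and \<delta>1: "\<forall>(k::nat) l r.
        (\<forall>i<k. a \<le> l i \<and> l i \<le> r i \<and> r i \<le> b) \<and>
        disjoint_family_on (\<lambda>i. {l i<..<r i}) {..<k} \<and> (\<Sum>i<k. r i - l i) < \<delta>1 \<longrightarrow>
        (\<Sum>i<k. norm (\<phi> (r i) - \<phi> (l i))) < \<epsilon> / 2"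
    using mp[OF spec[OF \<phi>[unfolded abs_continuous_on_def]] \<open>\<epsilon> / 2 > 0\<close>] by (elim exE conjE)
  obtain \<delta>2 where "\<delta>2 > 0" and \<delta>2: "\<forall>(k::nat) l r.
        (\<forall>i<k. b \<le> l i \<and> l i \<le> r i \<and> r i \<le> c) \<and>
        disjoint_family_on (\<lambda>i. {l i<..<r i}) {..<k} \<and> (\<Sum>i<k. r i - l i) < \<delta>2 \<longrightarrow>
        (\<Sum>i<k. norm (\<xi> (r i) - \<xi> (l i))) < \<epsilon> / 2"
    using mp[OF spec[OF \<xi>[unfolded abs_continuous_on_def]] \<open>\<epsilon> / 2 > 0\<close>] by (elim exE conjE)
  let ?\<psi> = "\<lambda>s. if s \<le> b then \<phi> s else \<xi> s"
  show "\<exists>\<delta>>0. \<forall>(k::nat) l r. (\<forall>i<k. a \<le> l i \<and> l i \<le> r i \<and> r i \<le> c) \<and>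
      disjoint_family_on (\<lambda>i. {l i<..<r i}) {..<k} \<and> (\<Sum>i<k. r i - l i) < \<delta> \<longrightarrow>
      (\<Sum>i<k. norm (?\<psi> (r i) - ?\<psi> (l i))) < \<epsilon>"
  proof (intro exI[of _ "min \<delta>1 \<delta>2"] conjI allI impI)
    fix k :: nat and l r :: "nat \<Rightarrow> real"
    assume *: "(\<forall>i<k. a \<le> l i \<and> l i \<le> r i \<and> r i \<le> c) \<and>
      disjoint_family_on (\<lambda>i. {l i<..<r i}) {..<k} \<and> (\<Sum>i<k. r i - l i) < min \<delta>1 \<delta>2"
    then have lr: "a \<le> l i" "l i \<le> r i" "r i \<le> c" if "i < k" for i using that by auto
    have disj: "disjoint_family_on (\<lambda>i. {l' i<..<r' i}) {..<k}"
      if "\<And>i. i < k \<Longrightarrow> {l' i<..<r' i} \<subseteq> {l i<..<r i}" for l' r' :: "nat \<Rightarrow> real"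
      unfolding disjoint_family_on_def
    proof (intro ballI impI)
      fix i j assume ij: "i \<in> {..<k}" "j \<in> {..<k}" "i \<noteq> j"
      then have "{l i<..<r i} \<inter> {l j<..<r j} = {}"
        using * unfolding disjoint_family_on_def by blast
      then show "{l' i<..<r' i} \<inter> {l' j<..<r' j} = {}"
        using that[of i] that[of j] ij by blast
    qed
    have in1: "a \<le> min (l i) b \<and> min (l i) b \<le> min (r i) b \<and> min (r i) b \<le> b"
      and len1: "min (r i) b - min (l i) b \<le> r i - l i"
      and sub1: "{min (l i) b<..<min (r i) b} \<subseteq> {l i<..<r i}" if "i < k" for i
      using lr[OF that] ab by (auto simp: min_def)
    have "(\<Sum>i<k. min (r i) b - min (l i) b) \<le> (\<Sum>i<k. r i - l i)"
      by (rule sum_mono) (use len1 in simp)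
    then have "(\<Sum>i<k. min (r i) b - min (l i) b) < \<delta>1" using * by simp
    then have 1: "(\<Sum>i<k. norm (\<phi> (min (r i) b) - \<phi> (min (l i) b))) < \<epsilon> / 2"
      using in1 disj[OF sub1] by (intro \<delta>1[rule_format]) auto
    have in2: "b \<le> max (l i) b \<and> max (l i) b \<le> max (r i) b \<and> max (r i) b \<le> c"
      and len2: "max (r i) b - max (l i) b \<le> r i - l i"
      and sub2: "{max (l i) b<..<max (r i) b} \<subseteq> {l i<..<r i}" if "i < k" for i
      using lr[OF that] bc by (auto simp: max_def)
    have "(\<Sum>i<k. max (r i) b - max (l i) b) \<le> (\<Sum>i<k. r i - l i)"
      by (rule sum_mono) (use len2 in simp)
    then have "(\<Sum>i<k. max (r i) b - max (l i) b) < \<delta>2" using * by simp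
    then have 2: "(\<Sum>i<k. norm (\<xi> (max (r i) b) - \<xi> (max (l i) b))) < \<epsilon> / 2"
      using in2 disj[OF sub2] by (intro \<delta>2[rule_format]) auto
    have "(\<Sum>i<k. norm (?\<psi> (r i) - ?\<psi> (l i))) \<le>
      (\<Sum>i<k. norm (\<phi> (min (r i) b) - \<phi> (min (l i) b)) +
              norm (\<xi> (max (r i) b) - \<xi> (max (l i) b)))"
    proof (rule sum_mono)
      fix i assume "i \<in> {..<k}"
      then have "l i \<le> r i" using lr by auto
      then consider "r i \<le> b" | "l i \<le> b" "b < r i" | "b < l i" by linarith
      then show "norm (?\<psi> (r i) - ?\<psi> (l i)) \<le> norm (\<phi> (min (r i) b) - \<phi> (min (l i) b)) +
              norm (\<xi> (max (r i) b) - \<xi> (max (l i) b))"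
      proof cases
        case 2
        then show ?thesis
          using norm_triangle_ineq[of "\<phi> b - \<phi> (l i)" "\<xi> (r i) - \<xi> b"] eq by simp
      qed (use \<open>l i \<le> r i\<close> in \<open>auto simp: min_def max_def\<close>)
    qed
    also have "\<dots> < \<epsilon>" using 1 2 by (simp add: sum.distrib)
    finally show "(\<Sum>i<k. norm (?\<psi> (r i) - ?\<psi> (l i))) < \<epsilon>" .
  qed (use \<open>\<delta>1 > 0\<close> \<open>\<delta>2 > 0\<close> in auto)
qed

text \<open>The derivative is bounded on the compact interval, so the function is Lipschitz.\<close>
lemma continuous_derivative_imp_abs_continuous_on:
  fixes \<xi> :: "real \<Rightarrow> 'a::real_normed_vector"
  assumes der: "\<And>s. s \<in> {a..b} \<Longrightarrow> (\<xi> has_vector_derivative d s) (at s within {a..b})"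
    and cont: "continuous_on {a..b} d"
  shows "abs_continuous_on a b \<xi>"
proof -
  have "bounded (d ` {a..b})"
    using cont by (intro compact_imp_bounded compact_continuous_image) auto
  then obtain B where "B > 0" and B: "\<And>s. s \<in> {a..b} \<Longrightarrow> norm (d s) \<le> B"
    by (auto simp: bounded_pos)
  have "B-lipschitz_on {a..b} \<xi>"
  proof (rule lipschitz_onI)
    fix x y assume xy: "x \<in> {a..b}" "y \<in> {a..b}"
    have "norm (\<xi> x - \<xi> y) \<le> B * norm (x - y)"
    proof (rule differentiable_bound[of "{a..b}" \<xi> "\<lambda>s h. h *\<^sub>R d s"])
      show "onorm (\<lambda>h. h *\<^sub>R d s) \<le> B" if "s \<in> {a..b}" for s
        using B[OF that] by (intro onorm_bound) (auto simp: \<open>B > 0\<close> less_imp_le mult.commute[of B] intro!: mult_left_mono)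
    qed (use der xy in \<open>auto simp: has_vector_derivative_def\<close>)
    then show "dist (\<xi> x) (\<xi> y) \<le> B * dist x y" by (simp add: dist_norm)
  qed (use \<open>B > 0\<close> in simp)
  then show ?thesis by (rule lipschitz_on_imp_abs_continuous_on)
qed

section \<open>Global solutions for Lipschitz vector fields\<close>

text \<open>
  Picard's integral operator, conjugated by the weight \<open>w s = exp (2 L (s - a))\<close>, is a contraction
  with factor \<open>1/2\<close> on the whole interval at once: the weight grows at twice the rate at which
  \<open>F\<close> can separate two curves. The time argument is clamped to \<open>[a, b]\<close>, so that
  the operator acts on bounded continuous functions on the line.
\<close>
lemma lipschitz_ode_solution_exists:
  fixes F :: "'a::euclidean_space \<Rightarrow> 'a" and a b :: real
  assumes F: "L-lipschitz_on UNIV F" and ab: "a \<le> b"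
  shows "\<exists>\<xi>. \<xi> a = y \<and>
    (\<forall>s\<in>{a..b}. (\<xi> has_vector_derivative F (\<xi> s)) (at s within {a..b}))"
proof -
  have "L \<ge> 0" using F by (rule lipschitz_on_nonneg)
  have contF: "continuous_on UNIV F" using F by (rule lipschitz_on_continuous_on)
  define w where "w s = exp (2 * L * (s - a))" for s
  have w_pos: "w s > 0" for s by (simp add: w_def)
  have contw: "continuous_on S w" for S unfolding w_def by (intro continuous_intros)
  define c where "c s = max a (min s b)" for s
  have c_in: "c s \<in> {a..b}" for s using ab by (auto simp: c_def)
  have c_id: "c s = s" if "s \<in> {a..b}" for s using that by (auto simp: c_def)
  have contc: "continuous_on UNIV c" unfolding c_def by (intro continuous_intros)
  define I where "I h m = inverse (w m) *\<^sub>R integral {a..m} (\<lambda>\<tau>. F (y + w \<tau> *\<^sub>R h \<tau>))"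
    for h :: "real \<Rightarrow> 'a" and m
  define \<Phi> where "\<Phi> h = Bcontfun (\<lambda>s. I (apply_bcontfun h) (c s))" for h :: "real \<Rightarrow>\<^sub>C 'a"
  have cont_in: "continuous_on S (\<lambda>\<tau>. F (y + w \<tau> *\<^sub>R apply_bcontfun h \<tau>))" for h :: "real \<Rightarrow>\<^sub>C 'a" and S
    by (intro continuous_on_compose2[OF contF] continuous_intros contw) auto
  have \<Phi>: "apply_bcontfun (\<Phi> h) s = I h (c s)" for h s
  proof -
    have contI: "continuous_on {a..b} (I h)"
      unfolding I_def
      by (intro continuous_intros contw indefinite_integral_continuous_1
          integrable_continuous_real cont_in) (use w_pos in \<open>simp add: less_imp_neq[symmetric]\<close>)
    have "bounded (I h ` {a..b})"
      using contI by (intro compact_imp_bounded compact_continuous_image) auto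
    then have "bounded (range (\<lambda>s. I h (c s)))"
      by (rule bounded_subset) (use c_in in auto)
    moreover have "continuous_on UNIV (\<lambda>s. I h (c s))"
      by (rule continuous_on_compose2[OF contI contc]) (use c_in in auto)
    ultimately show ?thesis
      unfolding \<Phi>_def by (subst Bcontfun_inverse) (auto simp: bcontfun_def)
  qed
  have "dist (\<Phi> h) (\<Phi> k) \<le> 1/2 * dist h k" for h k
  proof (rule dist_bound)
    fix s
    define m where "m = c s"
    have m: "a \<le> m" using c_in[of s] by (simp add: m_def)
    let ?d = "dist h k"
    have hi: "((\<lambda>\<tau>. L * w \<tau> * ?d) has_integral (?d / 2 * w m - ?d / 2 * w a)) {a..m}"
    proof (rule fundamental_theorem_of_calculus[OF m])
      fix x assume "x \<in> {a..m}"
      show "((\<lambda>x. ?d / 2 * w x) has_vector_derivative L * w x * ?d) (at x within {a..m})"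
        unfolding w_def has_real_derivative_iff_has_vector_derivative[symmetric]
        by (auto intro!: derivative_eq_intros)
    qed
    note bd = integral_unique[OF hi] and int = has_integral_integrable[OF hi]
    have "norm (integral {a..m} (\<lambda>\<tau>. F (y + w \<tau> *\<^sub>R h \<tau>) - F (y + w \<tau> *\<^sub>R k \<tau>)))
      \<le> integral {a..m} (\<lambda>\<tau>. L * w \<tau> * ?d)"
    proof (rule integral_norm_bound_integral[OF _ int])
      fix \<tau>
      have "norm (F (y + w \<tau> *\<^sub>R h \<tau>) - F (y + w \<tau> *\<^sub>R k \<tau>))
        \<le> L * norm ((y + w \<tau> *\<^sub>R h \<tau>) - (y + w \<tau> *\<^sub>R k \<tau>))"
        using lipschitz_onD[OF F, of "y + w \<tau> *\<^sub>R h \<tau>" "y + w \<tau> *\<^sub>R k \<tau>"] by (simp add: dist_norm)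
      also have "\<dots> = L * (w \<tau> * dist (h \<tau>) (k \<tau>))"
        using w_pos[of \<tau>] by (simp add: dist_norm scaleR_right_diff_distrib[symmetric])
      also have "\<dots> \<le> L * (w \<tau> * ?d)"
        using w_pos[of \<tau>] \<open>L \<ge> 0\<close> by (intro mult_left_mono dist_bounded) auto
      finally show "norm (F (y + w \<tau> *\<^sub>R h \<tau>) - F (y + w \<tau> *\<^sub>R k \<tau>)) \<le> L * w \<tau> * ?d"
        by (simp add: mult.assoc)
    qed (intro integrable_continuous_real continuous_intros cont_in)
    also have "\<dots> \<le> ?d / 2 * w m" using bd w_pos[of a] by simp
    finally have le: "norm (integral {a..m} (\<lambda>\<tau>. F (y + w \<tau> *\<^sub>R h \<tau>) - F (y + w \<tau> *\<^sub>R k \<tau>)))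
      \<le> ?d / 2 * w m" .
    have "integral {a..m} (\<lambda>\<tau>. F (y + w \<tau> *\<^sub>R h \<tau>)) - integral {a..m} (\<lambda>\<tau>. F (y + w \<tau> *\<^sub>R k \<tau>))
        = integral {a..m} (\<lambda>\<tau>. F (y + w \<tau> *\<^sub>R h \<tau>) - F (y + w \<tau> *\<^sub>R k \<tau>))"
      by (rule integral_diff[symmetric]) (intro integrable_continuous_real cont_in)+
    then have "dist (I h m) (I k m) =
      inverse (w m) * norm (integral {a..m} (\<lambda>\<tau>. F (y + w \<tau> *\<^sub>R h \<tau>) - F (y + w \<tau> *\<^sub>R k \<tau>)))"
      using w_pos[of m] by (simp add: I_def dist_norm scaleR_right_diff_distrib[symmetric])
    also have "\<dots> \<le> inverse (w m) * (?d / 2 * w m)"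
      using w_pos[of m] by (intro mult_left_mono le) simp
    also have "\<dots> = 1/2 * ?d" using w_pos[of m] by (simp add: field_simps)
    finally show "dist (\<Phi> h s) (\<Phi> k s) \<le> 1/2 * ?d" by (simp add: \<Phi> m_def)
  qed
  then obtain h where h: "\<Phi> h = h"
    using banach_fix_type[of "1/2" \<Phi>] by auto
  define \<xi> where "\<xi> s = y + w s *\<^sub>R h s" for s
  have \<xi>: "\<xi> s = y + integral {a..s} (\<lambda>\<tau>. F (\<xi> \<tau>))" if "s \<in> {a..b}" for s
  proof -
    have "h s = I h s" using \<Phi>[of h s] h c_id[OF that] by simp
    then have "w s *\<^sub>R h s = integral {a..s} (\<lambda>\<tau>. F (y + w \<tau> *\<^sub>R h \<tau>))"
      using w_pos[of s] by (simp add: I_def)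
    then show ?thesis by (simp add: \<xi>_def)
  qed
  have "(\<xi> has_vector_derivative F (\<xi> s)) (at s within {a..b})" if s: "s \<in> {a..b}" for s
  proof (rule has_vector_derivative_transform[OF s])
    have "continuous_on {a..b} (\<lambda>\<tau>. F (\<xi> \<tau>))" unfolding \<xi>_def by (rule cont_in)
    from integral_has_vector_derivative[OF this s]
    show "((\<lambda>s. y + integral {a..s} (\<lambda>\<tau>. F (\<xi> \<tau>))) has_vector_derivative F (\<xi> s)) (at s within {a..b})"
      by (auto intro!: derivative_eq_intros)
  qed (use \<xi> in simp)
  moreover have "\<xi> a = y" using \<xi>[of a] ab by simp
  ultimately show ?thesis by blast
qed

section \<open>Control systems\<close>

lemma AE_lebesgue_on_Icc_iff:
  "(AE s in lebesgue_on {a..b::real}. P s) \<longleftrightarrow> (AE s in lebesgue. s \<in> {a..b} \<longrightarrow> P s)"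
  by (rule AE_restrict_space_iff) simp

text \<open>
  A point of the reachable set must lie on a trajectory defined on all of \<open>[0, T]\<close>. A
  trajectory that reaches it earlier is prolonged with zero input, along the flow of
  \<open>\<lambda>x. F x 0\<close>, which exists globally because that field is Lipschitz.
\<close>
lemma trajectory_endpoint_reachable:
  fixes F :: "'x::euclidean_space \<Rightarrow> 'u::euclidean_space \<Rightarrow> 'x"
  assumes lip: "L-lipschitz_on UNIV (\<lambda>x. F x 0)" and "0 \<in> U"
    and t: "t \<in> {0..T}" and u: "control_signal U t u" and \<phi>: "trajectory F x0 t u \<phi>"
  shows "\<phi> t \<in> reachable_set F U T x0"
proof -
  obtain \<xi> where \<xi>t: "\<xi> t = \<phi> t"
    and \<xi>: "\<And>s. s \<in> {t..T} \<Longrightarrow> (\<xi> has_vector_derivative F (\<xi> s) 0) (at s within {t..T})"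
    using lipschitz_ode_solution_exists[OF lip, of t T "\<phi> t"] t by auto
  define v where "v s = (if s \<in> {0..t} then u s else 0)" for s
  define \<psi> where "\<psi> s = (if s \<le> t then \<phi> s else \<xi> s)" for s
  have "control_signal U T v"
    unfolding control_signal_def
  proof
    show "v \<in> borel_measurable (lebesgue_on {0..T})"
      unfolding v_def using t u
      by (subst borel_measurable_if_lebesgue_on) (auto simp: control_signal_def)
    show "\<forall>s\<in>{0..T}. v s \<in> U"
      using u \<open>0 \<in> U\<close> by (auto simp: v_def control_signal_def)
  qed
  moreover have "trajectory F x0 T v \<psi>"
    unfolding trajectory_def
  proof (intro conjI)
    have "continuous_on {t..T} \<xi>"
      unfolding continuous_on_eq_continuous_within
      using \<xi> has_vector_derivative_continuous by blast
    then have "continuous_on {t..T} (\<lambda>s. F (\<xi> s) 0)"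
      by (rule continuous_on_compose2[OF lipschitz_on_continuous_on[OF lip]]) auto
    then have "abs_continuous_on t T \<xi>"
      using \<xi> by (intro continuous_derivative_imp_abs_continuous_on) auto
    then show "abs_continuous_on 0 T \<psi>"
      unfolding \<psi>_def using \<phi> t \<xi>t by (intro abs_continuous_on_join) (auto simp: trajectory_def)
    show "\<psi> 0 = x0" using \<phi> t by (simp add: \<psi>_def trajectory_def)
    have "AE s in lebesgue. s \<noteq> t"
      by (rule AE_completion) (rule AE_lborel_singleton)
    moreover have "AE s in lebesgue. s \<in> {0..t} \<longrightarrow>
        (\<phi> has_vector_derivative F (\<phi> s) (u s)) (at s within {0..t})"
      using \<phi> by (simp add: trajectory_def AE_lebesgue_on_Icc_iff)
    ultimately have "AE s in lebesgue. s \<in> {0..T} \<longrightarrow>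
        (\<psi> has_vector_derivative F (\<psi> s) (v s)) (at s within {0..T})"
    proof eventually_elim
      case (elim s)
      show ?case
      proof
        assume s: "s \<in> {0..T}"
        show "(\<psi> has_vector_derivative F (\<psi> s) (v s)) (at s within {0..T})"
        proof (cases "s < t")
          case True
          have "(\<phi> has_vector_derivative F (\<phi> s) (u s)) (at s within {0..t})"
            using elim s True by auto
          also have "at s within {0..t} = at s within {0..T}"
            by (rule at_within_nhd[of _ "{..<t}"]) (use True t in auto)
          finally show ?thesis
            by (rule has_vector_derivative_transform_within[where d = "t - s", THEN has_vector_derivative_eq_rhs])
              (use True s in \<open>auto simp: \<psi>_def v_def dist_real_def\<close>)
        next
          case False
          then have "s > t" using elim by simp
          then have "(\<xi> has_vector_derivative F (\<xi> s) 0) (at s within {t..T})"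
            using \<xi> s by auto
          also have "at s within {t..T} = at s within {0..T}"
            by (rule at_within_nhd[of _ "{t<..}"]) (use \<open>s > t\<close> t in auto)
          finally show ?thesis
            by (rule has_vector_derivative_transform_within[where d = "s - t", THEN has_vector_derivative_eq_rhs])
              (use \<open>s > t\<close> s in \<open>auto simp: \<psi>_def v_def dist_real_def\<close>)
        qed
      qed
    qed
    then show "AE s in lebesgue_on {0..T}.
        (\<psi> has_vector_derivative F (\<psi> s) (v s)) (at s within {0..T})"
      by (simp add: AE_lebesgue_on_Icc_iff)
  qed
  moreover have "\<psi> t = \<phi> t" by (simp add: \<psi>_def)
  ultimately show ?thesis
    unfolding reachable_set_def using t by (intro CollectI exI[of _ v] exI[of _ \<psi>] exI[of _ t]) auto
qed

text \<open>
  Invertibility of the right factor at \<open>0\<close> makes the range of \<open>R\<close> that of \<open>G 0\<close>.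
\<close>
lemma factorizable_range:
  fixes f :: "real^'n \<Rightarrow> real^'n" and G :: "real^'n \<Rightarrow> real^'m^'n"
  assumes "factorizable f G"
  shows "f x \<in> range ((*v) (G 0))" and "G x *v v \<in> range ((*v) (G 0))"
proof -
  obtain R :: "real^'m^'n" and r H
    where f: "\<And>x. f x = R *v r x" and G: "\<And>x. G x = R ** H x" and "invertible (H 0)"
    using assms unfolding factorizable_def by blast
  then obtain B where B: "H 0 ** B = mat 1" by (auto simp: invertible_def)
  have R: "R *v y \<in> range ((*v) (G 0))" for y
  proof
    show "R *v y = G 0 *v (B *v y)"
      by (metis G B matrix_mul_assoc matrix_mul_rid matrix_vector_mul_assoc)
  qed simp
  show "f x \<in> range ((*v) (G 0))" unfolding f by (rule R)
  show "G x *v v \<in> range ((*v) (G 0))"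
    unfolding G[of x] matrix_vector_mul_assoc[symmetric] by (rule R)
qed

text \<open>
  Inverting a perturbation \<open>A\<close> of \<open>M\<close> on the range of \<open>M\<close>. With \<open>P\<close> a generalized inverse of
  \<open>M\<close>, \<open>A P\<close> agrees on that range with \<open>B = 1 + (A - M) P\<close>, and the
  perturbation \<open>(A - M) P\<close> of the identity is a strict contraction that maps into the range, so
  the solution of \<open>B z = w\<close> stays in it. The norm bound is that of the Neumann series.
\<close>
lemma perturbed_right_inverse:
  fixes M A :: "real^'m^'n" and P :: "real^'n^'m"
  defines "B \<equiv> mat 1 + (A - M) ** P"
  assumes MPM: "M ** P ** M = M" and d: "mat_norm (A - M) \<le> d" and small: "d * mat_norm P < 1"
    and A_range: "range ((*v) A) \<subseteq> range ((*v) M)"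
  shows "det B \<noteq> 0"
    and "norm z * (1 - d * mat_norm P) \<le> norm (B *v z)"
    and "B *v z \<in> range ((*v) M) \<Longrightarrow> A *v (P *v z) = B *v z"
proof -
  have B: "B *v z = z + (A - M) *v (P *v z)" for z
    by (simp add: B_def matrix_vector_mult_add_rdistrib matrix_vector_mul_assoc)
  have lower: "norm z * (1 - d * mat_norm P) \<le> norm (B *v z)" for z
  proof -
    have "norm ((A - M) *v (P *v z)) \<le> mat_norm (A - M) * norm (P *v z)"
      by (rule norm_mult_le_mat_norm)
    also have "\<dots> \<le> d * (mat_norm P * norm z)"
      using d mat_norm_nonneg[of "A - M"] by (intro mult_mono norm_mult_le_mat_norm) auto
    finally have "norm ((A - M) *v (P *v z)) \<le> d * mat_norm P * norm z" by simp
    moreover have "norm z - norm ((A - M) *v (P *v z)) \<le> norm (B *v z)"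
      unfolding B by (rule norm_diff_ineq)
    ultimately show ?thesis by (simp add: algebra_simps)
  qed
  then show "norm z * (1 - d * mat_norm P) \<le> norm (B *v z)" .
  have "z = 0" if "B *v z = 0" for z
    using lower[of z] small that by (simp add: mult_le_0_iff)
  then show "det B \<noteq> 0"
    by (metis invertible_det_nz invertible_left_inverse matrix_left_invertible_ker)
  have sub: "subspace (range ((*v) M))"
    by (rule linear_subspace_image) auto
  assume "B *v z \<in> range ((*v) M)"
  moreover have "(A - M) *v (P *v z) \<in> range ((*v) M)"
    unfolding matrix_vector_mult_diff_rdistrib
    using A_range by (intro subspace_diff[OF sub]) auto
  ultimately have "B *v z - (A - M) *v (P *v z) \<in> range ((*v) M)"
    by (rule subspace_diff[OF sub])
  then obtain x where "z = M *v x" by (auto simp: B)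
  then have "M *v (P *v z) = z"
    by (metis matrix_vector_mul_assoc MPM)
  then show "A *v (P *v z) = B *v z"
    by (simp add: B matrix_vector_mult_diff_rdistrib)
qed

text \<open>
  Along a curve \<open>\<phi>\<close>, each velocity \<open>w\<close> within the guaranteed budget \<open>1/\<parallel>P\<parallel> - LG \<parallel>\<phi>\<parallel>\<close> is produced by
  an admissible input \<open>P z\<close>, where \<open>z\<close> solves a linear system depending measurably on time: the
  same \<open>LG \<parallel>\<phi>\<parallel>\<close> bounds the loss of control authority from \<open>G 0\<close> to \<open>G (\<phi> s)\<close>, so
  \<open>\<parallel>z\<parallel> \<le> 1/\<parallel>P\<parallel>\<close>.
\<close>
lemma control_signal_realizing_velocity:
  fixes G :: "real^'n \<Rightarrow> real^'m^'n" and P :: "real^'n^'m"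
    and \<phi> w :: "real \<Rightarrow> real^'n"
  defines "p \<equiv> mat_norm P"
  assumes lip: "mat_lipschitz LG G"
    and G_range: "\<And>x. range ((*v) (G x)) \<subseteq> range ((*v) (G 0))"
    and MPM: "G 0 ** P ** G 0 = G 0" and "p > 0"
    and \<phi>: "continuous_on {0..t} \<phi>"
    and near: "\<And>s. s \<in> {0..t} \<Longrightarrow> LG * norm (\<phi> s) < inverse p"
    and w: "w \<in> borel_measurable (lebesgue_on {0..t})"
    and w_range: "\<And>s. s \<in> {0..t} \<Longrightarrow> w s \<in> range ((*v) (G 0))"
    and w_le: "\<And>s. s \<in> {0..t} \<Longrightarrow> norm (w s) \<le> inverse p - LG * norm (\<phi> s)"
  shows "\<exists>v. control_signal (cball 0 1) t v \<and> (\<forall>s\<in>{0..t}. G (\<phi> s) *v v s = w s)"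
proof -
  define B where "B s = mat 1 + (G (\<phi> s) - G 0) ** P" for s
  have d: "mat_norm (G (\<phi> s) - G 0) \<le> LG * norm (\<phi> s)" for s
    using lip[unfolded mat_lipschitz_def, rule_format, of "\<phi> s" 0] by simp
  have small: "LG * norm (\<phi> s) * p < 1" if "s \<in> {0..t}" for s
    using near[OF that] \<open>p > 0\<close> by (simp add: field_simps)
  note inv = perturbed_right_inverse[OF MPM d small[unfolded p_def] G_range, folded p_def B_def]
  have "\<exists>x. B s *v x = w s" if "s \<in> {0..t}" for s
    using cramer[OF inv(1)[OF that]] by blast
  then obtain z where z: "\<And>s. s \<in> {0..t} \<Longrightarrow> B s *v z s = w s" by metis
  have "z \<in> borel_measurable (lebesgue_on {0..t})"
  proof (rule borel_measurable_linear_system[of B _ w])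
    have "continuous_on {0..t} (\<lambda>s. G (\<phi> s))"
      by (rule continuous_on_compose2[OF mat_lipschitz_imp_continuous[OF lip] \<phi>]) simp
    then have "continuous_on {0..t} B"
      unfolding B_def matrix_matrix_mult_def by (intro continuous_intros)
    then show "B \<in> borel_measurable (lebesgue_on {0..t})"
      by (rule continuous_imp_measurable_on_sets_lebesgue) simp
  qed (use w inv(1) z in auto)
  then have "(\<lambda>s. P *v z s) \<in> borel_measurable (lebesgue_on {0..t})"
    by (rule borel_measurable_continuous_on[rotated])
      (intro linear_continuous_on matrix_vector_mul_bounded_linear)
  moreover have "norm (P *v z s) \<le> 1" if s: "s \<in> {0..t}" for s
  proof -
    have "norm (z s) * (1 - LG * norm (\<phi> s) * p) \<le> norm (w s)"
      using inv(2)[OF s, of "z s"] z[OF s] by simp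
    also have "\<dots> \<le> inverse p - LG * norm (\<phi> s)"
      by (rule w_le[OF s])
    also have "\<dots> = inverse p * (1 - LG * norm (\<phi> s) * p)"
      using \<open>p > 0\<close> by (simp add: right_diff_distrib)
    finally have "norm (z s) \<le> inverse p"
      by (rule mult_right_le_imp_le) (use small[OF s] in simp)
    then have "p * norm (z s) \<le> p * inverse p"
      using \<open>p > 0\<close> by (intro mult_left_mono) auto
    then have "p * norm (z s) \<le> 1" using \<open>p > 0\<close> by simp
    then show ?thesis
      using norm_mult_le_mat_norm[of P "z s"] by (simp add: p_def)
  qed
  moreover have "G (\<phi> s) *v (P *v z s) = w s" if s: "s \<in> {0..t}" for s
    using inv(3)[OF s, of "z s"] z[OF s] w_range[OF s] by simp
  ultimately show ?thesis
    by (intro exI[of _ "\<lambda>s. P *v z s"]) (auto simp: control_signal_def)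
qed

theorem theorem3:
  fixes f :: "real^'n \<Rightarrow> real^'n" and G :: "real^'n \<Rightarrow> real^'m^'n"
    and Lf LG T :: real and g :: "real \<Rightarrow> real"
  assumes "Lf > 0" and "LG > 0"
    and "Lf-lipschitz_on UNIV f"
    and "mat_lipschitz LG G"
    and "factorizable f G"
    and "G 0 \<noteq> 0"
    and "T \<ge> 0"
    and g: "\<And>s. s \<le> inverse (mat_norm (pinv (G 0))) / (Lf + LG) \<Longrightarrow>
              g s = inverse (mat_norm (pinv (G 0))) - (Lf + LG) * s"
  shows "reachable_set_in
           {x. norm x \<le> inverse (mat_norm (pinv (G 0))) / (Lf + LG)}
           (\<lambda>x u. f 0 + g (norm x) *\<^sub>R u)
           (cball 0 1 \<inter> range ((*v) (G 0)))
           T 0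
         \<subseteq> guaranteed_reachable_set Lf LG f G T 0"
proof -
  define P where "P = pinv (G 0)"
  define p where "p = mat_norm P"
  have MPM: "G 0 ** P ** G 0 = G 0"
    using is_pinv_pinv[of "G 0"] by (simp add: is_pinv_def P_def)
  then have "P \<noteq> 0" using \<open>G 0 \<noteq> 0\<close> by auto
  then have "p > 0" unfolding p_def by (rule mat_norm_pos)
  have sub: "subspace (range ((*v) (G 0)))"
    by (rule linear_subspace_image) auto
  have "\<phi> t \<in> reachable_set (\<lambda>x u. f' x + G' x *v u) (cball 0 1) T 0"
    if t: "t \<in> {0..T}"
      and u: "control_signal (cball 0 1 \<inter> range ((*v) (G 0))) t u"
      and \<phi>: "trajectory (\<lambda>x u. f 0 + g (norm x) *\<^sub>R u) 0 t u \<phi>"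
      and dom: "\<forall>s\<in>{0..t}. norm (\<phi> s) \<le> inverse p / (Lf + LG)"
      and con: "(f', G') \<in> consistent_systems Lf LG f G" for t u \<phi> f' G'
  proof -
    from con have lipf: "Lf-lipschitz_on UNIV f'" and lipG: "mat_lipschitz LG G'"
      and f0: "f' 0 = f 0" and G0: "G' 0 = G 0" and fac: "factorizable f' G'"
      by (auto simp: consistent_systems_def)
    have cont: "continuous_on {0..t} \<phi>"
      using \<phi> by (auto simp: trajectory_def intro: abs_continuous_on_imp_continuous_on)
    \<comment> \<open>The velocity that the input of the unknown system has to supply.\<close>
    define w where "w s = g (norm (\<phi> s)) *\<^sub>R u s - (f' (\<phi> s) - f' 0)" for s
    have g_eq: "g (norm (\<phi> s)) = inverse p - (Lf + LG) * norm (\<phi> s)" if "s \<in> {0..t}" for s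
      using dom that by (simp add: g P_def p_def)
    have budget: "(Lf + LG) * norm (\<phi> s) \<le> inverse p" if "s \<in> {0..t}" for s
      using bspec[OF dom that] \<open>Lf > 0\<close> \<open>LG > 0\<close> by (simp add: pos_le_divide_eq mult.commute)
    have "\<exists>v. control_signal (cball 0 1) t v \<and> (\<forall>s\<in>{0..t}. G' (\<phi> s) *v v s = w s)"
    proof (rule control_signal_realizing_velocity[OF lipG, of P])
      show "range ((*v) (G' x)) \<subseteq> range ((*v) (G' 0))" for x
        using factorizable_range(2)[OF fac] by auto
      show "G' 0 ** P ** G' 0 = G' 0" by (simp add: G0 MPM)
      show "mat_norm P > 0" using \<open>p > 0\<close> by (simp add: p_def)
      show "continuous_on {0..t} \<phi>" by (rule cont)
      \<comment> \<open>On the boundary of the domain the inequality is strict because \<open>Lf > 0\<close>.\<close>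
      show "LG * norm (\<phi> s) < inverse (mat_norm P)" if s: "s \<in> {0..t}" for s
      proof (cases "\<phi> s = 0")
        case False
        then have "Lf * norm (\<phi> s) > 0" using \<open>Lf > 0\<close> by simp
        then show ?thesis using budget[OF s] by (simp add: p_def algebra_simps)
      qed (use \<open>p > 0\<close> in \<open>simp add: p_def\<close>)
      have "continuous_on {0..t} (\<lambda>s. inverse p - (Lf + LG) * norm (\<phi> s))"
        by (intro continuous_intros cont)
      then have "continuous_on {0..t} (\<lambda>s. g (norm (\<phi> s)))"
        by (rule continuous_on_eq) (simp add: g_eq)
      then have "(\<lambda>s. g (norm (\<phi> s))) \<in> borel_measurable (lebesgue_on {0..t})"
        by (rule continuous_imp_measurable_on_sets_lebesgue) simp
      moreover have "continuous_on {0..t} (\<lambda>s. f' (\<phi> s) - f' 0)"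
        by (intro continuous_intros continuous_on_compose2[OF lipschitz_on_continuous_on[OF lipf] cont]) simp
      then have "(\<lambda>s. f' (\<phi> s) - f' 0) \<in> borel_measurable (lebesgue_on {0..t})"
        by (rule continuous_imp_measurable_on_sets_lebesgue) simp
      moreover have "u \<in> borel_measurable (lebesgue_on {0..t})"
        using u by (simp add: control_signal_def)
      ultimately show "w \<in> borel_measurable (lebesgue_on {0..t})"
        unfolding w_def by (intro borel_measurable_diff[where f = "\<lambda>s. g (norm (\<phi> s)) *\<^sub>R u s"]
            borel_measurable_scaleR)
      fix s assume s: "s \<in> {0..t}"
      have us: "norm (u s) \<le> 1" "u s \<in> range ((*v) (G 0))"
        using u s by (auto simp: control_signal_def)
      show "w s \<in> range ((*v) (G' 0))"
        unfolding w_def G0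
        using us(2) factorizable_range(1)[OF fac, unfolded G0]
        by (intro subspace_diff[OF sub] subspace_scale[OF sub])
      have "norm (g (norm (\<phi> s)) *\<^sub>R u s) \<le> inverse p - (Lf + LG) * norm (\<phi> s)"
        using us(1) budget[OF s] by (simp add: g_eq[OF s] mult_left_le)
      moreover have "norm (f' (\<phi> s) - f' 0) \<le> Lf * norm (\<phi> s)"
        using lipschitz_onD[OF lipf, of "\<phi> s" 0] by (simp add: dist_norm)
      moreover have "norm (w s) \<le> norm (g (norm (\<phi> s)) *\<^sub>R u s) + norm (f' (\<phi> s) - f' 0)"
        unfolding w_def by (rule norm_triangle_ineq4)
      ultimately show "norm (w s) \<le> inverse (mat_norm P) - LG * norm (\<phi> s)"
        by (simp add: p_def algebra_simps)
    qed
    then obtain v where v: "control_signal (cball 0 1) t v"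
      and Gv: "\<And>s. s \<in> {0..t} \<Longrightarrow> G' (\<phi> s) *v v s = w s" by blast
    have rhs: "f' (\<phi> s) + G' (\<phi> s) *v v s = f 0 + g (norm (\<phi> s)) *\<^sub>R u s"
      if "s \<in> {0..t}" for s
      by (simp add: Gv[OF that] w_def f0)
    have "trajectory (\<lambda>x u. f' x + G' x *v u) 0 t v \<phi>"
      using \<phi> unfolding trajectory_def AE_lebesgue_on_Icc_iff
      by (auto simp: rhs elim!: eventually_mono)
    then show ?thesis
      using lipf t v by (intro trajectory_endpoint_reachable[where L = Lf]) auto
  qed
  then show ?thesis
    unfolding reachable_set_in_def guaranteed_reachable_set_def
    by (fastforce simp: p_def P_def)
qed

end
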